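(* Let $A\in\mathbb{R}^{n\times n}$, $B\in\mathbb{R}^{n\times p}$, $C\in\mathbb{R}^{m\times n}$, and let $R\in\mathbb{R}^{p\times p}$ be symmetric positive definite. Suppose $(A,B)$ is controllable and $(A,C)$ is observable, and let $P$ be the unique positive definite solution (which exists under these hypotheses) of the discrete-time algebraic Riccati equation $$P=A^\top PA-A^\top PB(R+B^\top PB)^{-1}B^\top PA+C^\top C.$$ Then there exists $\alpha>0$ such that, for every $X_1\in\mathbb{S}_+^n\setminus\{0\}$, the sequence $$X_{k+1}=A^\top\Big[X_k-X_kB\big(\alpha\,\mathrm{tr}(X_k)R+B^\top X_kB\big)^{-1}B^\top X_k\Big]A+\alpha\,\mathrm{tr}(X_k)\,C^\top C,\qquad k\ge1,$$ satisfies $d_{\mathcal H}(X_k,P)\to0$ as $k\to\infty$.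
   Context: $\mathbb{S}_+^n$ is the cone of real symmetric positive semidefinite $n\times n$ matrices, and $X\preceq Y$ means $Y-X\in\mathbb{S}_+^n$. The pair $(A,C)$ is observable if the stacked matrix $\mathrm{col}(C,CA,\dots,CA^{n-1})$ has full (column) rank $n$; $(A,B)$ is controllable if $[B,AB,\dots,A^{n-1}B]$ has rank $n$. For $X,Y\in\mathbb{S}_+^n\setminus\{0\}$ let $M(X/Y)=\inf\{\lambda: X\preceq\lambda Y\}$ and $m(X/Y)=\sup\{\mu:\mu Y\preceq X\}$. The Hilbert metric is $d_{\mathcal H}(X,Y)=\ln\frac{M(X/Y)}{m(X/Y)}\in[0,\infty]$, with value $+\infty$ if $M(X/Y)=\infty$ or $m(X/Y)=0$. *)

theory Defs
  imports "HOL-Analysis.Analysis"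
begin

text \<open>Powers for the matrix product; the library's \<open>*\<close>, and hence \<open>^\<close>, on \<open>real ^ 'n ^ 'n\<close>
  is componentwise.\<close>
primrec mat_power :: "real ^ 'n ^ 'n \<Rightarrow> nat \<Rightarrow> real ^ 'n ^ 'n" where
  "mat_power A 0 = mat 1"
| "mat_power A (Suc k) = A ** mat_power A k"

text \<open>\<open>to_nat_on UNIV\<close> is a bijection from the finite type \<open>'n\<close> onto \<open>{..<CARD('n)}\<close>. It lets \<open>'n\<close>
  index the \<open>n\<close> blocks of the matrices below: the block with index \<open>k\<close> belongs to the power
  \<open>to_nat_on UNIV k\<close>, so that each of the powers \<open>0, \<dots>, n - 1\<close> occurs exactly once.\<close>

definition observability_matrix :: "real ^ 'n ^ 'n \<Rightarrow> real ^ 'n ^ 'm \<Rightarrow> real ^ 'n ^ ('n \<times> 'm)" where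
  "observability_matrix A C =
     (\<chi> r j. (C ** mat_power A (to_nat_on (UNIV :: 'n set) (fst r))) $ snd r $ j)"

definition controllability_matrix :: "real ^ 'n ^ 'n \<Rightarrow> real ^ 'p ^ 'n \<Rightarrow> real ^ ('n \<times> 'p) ^ 'n" where
  "controllability_matrix A B =
     (\<chi> i c. (mat_power A (to_nat_on (UNIV :: 'n set) (fst c)) ** B) $ i $ snd c)"

definition observable :: "real ^ 'n ^ 'n \<Rightarrow> real ^ 'n ^ 'm \<Rightarrow> bool" where
  "observable A C \<longleftrightarrow> rank (observability_matrix A C) = CARD('n)"

definition controllable :: "real ^ 'n ^ 'n \<Rightarrow> real ^ 'p ^ 'n \<Rightarrow> bool" where
  "controllable A B \<longleftrightarrow> rank (controllability_matrix A B) = CARD('n)"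

definition psd :: "real ^ 'n ^ 'n \<Rightarrow> bool" where
  "psd X \<longleftrightarrow> transpose X = X \<and> (\<forall>v. 0 \<le> v \<bullet> (X *v v))"

definition pos_def :: "real ^ 'n ^ 'n \<Rightarrow> bool" where
  "pos_def X \<longleftrightarrow> transpose X = X \<and> (\<forall>v. v \<noteq> 0 \<longrightarrow> 0 < v \<bullet> (X *v v))"

definition loewner_le :: "real ^ 'n ^ 'n \<Rightarrow> real ^ 'n ^ 'n \<Rightarrow> bool" (infix \<open>\<preceq>\<close> 50) where
  "X \<preceq> Y \<longleftrightarrow> psd (Y - X)"

text \<open>The infimum of the empty set is \<open>\<infinity>\<close> in \<open>ereal\<close>.\<close>
definition hilbert_M :: "real ^ 'n ^ 'n \<Rightarrow> real ^ 'n ^ 'n \<Rightarrow> ereal" where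
  "hilbert_M X Y = (INF l \<in> {l. X \<preceq> l *\<^sub>R Y}. ereal l)"

definition hilbert_m :: "real ^ 'n ^ 'n \<Rightarrow> real ^ 'n ^ 'n \<Rightarrow> ereal" where
  "hilbert_m X Y = (SUP u \<in> {u. u *\<^sub>R Y \<preceq> X}. ereal u)"

text \<open>Meaningful for nonzero positive semidefinite arguments only: for these, \<open>hilbert_M X Y > 0\<close> and
  \<open>0 \<le> hilbert_m X Y < \<infinity>\<close>, so \<open>real_of_ereal\<close> is only applied to finite values.\<close>
definition hilbert_dist :: "real ^ 'n ^ 'n \<Rightarrow> real ^ 'n ^ 'n \<Rightarrow> ereal" where
  "hilbert_dist X Y =
     (if hilbert_M X Y = \<infinity> \<or> hilbert_m X Y = 0 then \<infinity>
      else ereal (ln (real_of_ereal (hilbert_M X Y) / real_of_ereal (hilbert_m X Y))))"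

definition dare :: "real ^ 'n ^ 'n \<Rightarrow> real ^ 'p ^ 'n \<Rightarrow> real ^ 'n ^ 'm \<Rightarrow> real ^ 'p ^ 'p \<Rightarrow>
    real ^ 'n ^ 'n \<Rightarrow> bool" where
  "dare A B C R P \<longleftrightarrow>
     P = transpose A ** P ** A
         - transpose A ** P ** B ** matrix_inv (R + transpose B ** P ** B) ** transpose B ** P ** A
         + transpose C ** C"

definition riccati_step :: "real ^ 'n ^ 'n \<Rightarrow> real ^ 'p ^ 'n \<Rightarrow> real ^ 'n ^ 'm \<Rightarrow> real ^ 'p ^ 'p \<Rightarrow>
    real \<Rightarrow> real ^ 'n ^ 'n \<Rightarrow> real ^ 'n ^ 'n" where
  "riccati_step A B C R \<alpha> X =
     transpose A
       ** (X - X ** B ** matrix_inv ((\<alpha> * trace X) *\<^sub>R R + transpose B ** X ** B) ** transpose B ** X)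
       ** A
     + (\<alpha> * trace X) *\<^sub>R (transpose C ** C)"

end

theory Submission
  imports Defs
begin

text \<open>Write \<open>ric r X\<close> for the Riccati map with weight \<open>r\<close>, so that the iteration is \<open>X \<mapsto> ric (\<alpha> tr X) X\<close>
  and the Riccati equation is \<open>P = ric 1 P\<close>. The quadratic form of \<open>ric r X\<close> is the minimum over the
  control \<open>u\<close> of a cost that is linear in \<open>(r, X)\<close>; hence \<open>ric\<close> is monotone, positively homogeneous and
  superadditive jointly in \<open>(r, X)\<close>, and so is the iteration map \<open>F\<close>. By observability the \<open>n\<close>-th iterate of
  \<open>ric r\<close> at \<open>0\<close> is positive definite.

  Existence of \<open>P\<close>: the iterates of \<open>ric 1\<close> at \<open>0\<close> increase and, by controllability, are bounded.
  Uniqueness: if \<open>t P \<preceq> Q\<close> for two solutions, superadditivity improves \<open>t\<close> to \<open>t + (1 - t) c\<close> with a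
  fixed \<open>c > 0\<close>, and repeating this gives \<open>P \<preceq> Q\<close>.

  Convergence: for \<open>\<alpha> = 1 / tr P\<close> the ray of \<open>P\<close> is fixed by \<open>F\<close>, and there is \<open>c > 0\<close> such that
  \<open>c (tr Y) P \<preceq> F\<^sup>n Y\<close> for all positive semidefinite \<open>Y\<close>. If \<open>a P \<preceq> X\<close>, superadditivity therefore gives
  \<open>(a + c tr (X - a P)) P \<preceq> F\<^sup>n X\<close>. The increasing sequence of lower bounds \<open>a\<close> obtained in this way is
  bounded, so \<open>tr (X - a P) \<rightarrow> 0\<close> along it, which squeezes the iterates onto the ray of \<open>P\<close>.\<close>

section \<open>The Loewner order\<close>

text \<open>Keeps products of the form \<open>transpose M *v w\<close> intact, so that
  \<open>inner_transpose_mult\<close> can rewrite them.\<close>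

declare transpose_matrix_vector [simp del]

lemma inner_transpose_mult: "v \<bullet> (transpose M *v w) = (M *v v) \<bullet> w"
  for M :: "real ^ 'a ^ 'b"
  by (metis dot_lmul_matrix vector_transpose_matrix transpose_transpose)

lemma transpose_add: "transpose (X + Y) = transpose X + transpose Y"
  by (simp add: transpose_def vec_eq_iff)

lemma transpose_diff: "transpose (X - Y) = transpose X - transpose Y"
  for X :: "real ^ 'a ^ 'b"
  by (simp add: transpose_def vec_eq_iff)

lemma scaleR_mult_vec: "(c *\<^sub>R X) *v v = c *\<^sub>R (X *v v)" for X :: "real ^ 'a ^ 'b"
  by (simp add: scaleR_matrix_vector_assoc)

lemma trace_scaleR: "trace (c *\<^sub>R X) = c * trace X" for X :: "real ^ 'n ^ 'n"
  by (simp add: trace_def sum_distrib_left)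

lemma psd_0 [simp]: "psd 0"
  by (simp add: psd_def transpose_def vec_eq_iff)

lemma psd_add: "psd X \<Longrightarrow> psd Y \<Longrightarrow> psd (X + Y)"
  by (simp add: psd_def transpose_add matrix_vector_mult_add_rdistrib inner_add_right)

lemma psd_scaleR: "psd X \<Longrightarrow> 0 \<le> c \<Longrightarrow> psd (c *\<^sub>R X)"
  by (simp add: psd_def transpose_scalar scaleR_mult_vec)

lemma pos_def_imp_psd: "pos_def X \<Longrightarrow> psd X"
  by (metis inner_zero_left less_eq_real_def pos_def_def psd_def)

lemma loewner_leI:
  assumes "transpose X = X" "transpose Y = Y" "\<And>v. v \<bullet> (X *v v) \<le> v \<bullet> (Y *v v)"
  shows "X \<preceq> Y"
  using assms
  by (simp add: loewner_le_def psd_def transpose_diff matrix_vector_mult_diff_rdistrib inner_diff_right)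

lemma loewner_leD: "X \<preceq> Y \<Longrightarrow> v \<bullet> (X *v v) \<le> v \<bullet> (Y *v v)"
  by (simp add: loewner_le_def psd_def matrix_vector_mult_diff_rdistrib inner_diff_right)

lemma loewner_le_refl [simp]: "X \<preceq> X"
  by (simp add: loewner_le_def)

lemma loewner_le_trans [trans]: "X \<preceq> Y \<Longrightarrow> Y \<preceq> Z \<Longrightarrow> X \<preceq> Z"
  using psd_add[of "Y - X" "Z - Y"] by (simp add: loewner_le_def)

lemma loewner_le_add: "X \<preceq> Y \<Longrightarrow> X' \<preceq> Y' \<Longrightarrow> X + X' \<preceq> Y + Y'"
  using psd_add[of "Y - X" "Y' - X'"] by (simp add: loewner_le_def algebra_simps)

lemma loewner_le_scaleR: "X \<preceq> Y \<Longrightarrow> 0 \<le> c \<Longrightarrow> c *\<^sub>R X \<preceq> c *\<^sub>R Y"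
  using psd_scaleR[of "Y - X" c] by (simp add: loewner_le_def algebra_simps)

lemma loewner_le_scaleR_right: "psd X \<Longrightarrow> a \<le> b \<Longrightarrow> a *\<^sub>R X \<preceq> b *\<^sub>R X"
  using psd_scaleR[of X "b - a"] by (simp add: loewner_le_def algebra_simps)

lemma psd_iff_loewner: "psd X \<longleftrightarrow> 0 \<preceq> X"
  by (simp add: loewner_le_def)

lemma psd_mono: "psd X \<Longrightarrow> X \<preceq> Y \<Longrightarrow> psd Y"
  by (metis loewner_le_trans psd_iff_loewner)

lemma pos_def_mono:
  assumes "pos_def X" "X \<preceq> Y"
  shows "pos_def Y"
  using assms psd_mono[OF pos_def_imp_psd[OF assms(1)] assms(2)] loewner_leD[OF assms(2)]
  by (metis order_less_le_trans pos_def_def psd_def)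

section \<open>Quadratic forms, entries and the trace\<close>

lemma entry_eq_inner: "X $ i $ j = axis i 1 \<bullet> (X *v axis j 1)" for X :: "real ^ 'n ^ 'm"
  by (simp add: matrix_vector_mult_basis column_def inner_axis')

lemma sym_inner_swap:
  "transpose X = X \<Longrightarrow> v \<bullet> (X *v w) = w \<bullet> (X *v v)" for X :: "real ^ 'n ^ 'n"
  by (metis inner_commute inner_transpose_mult)

lemma inner_sum_quadratic:
  fixes X :: "real ^ 'n ^ 'n"
  assumes "transpose X = X"
  shows "(v + w) \<bullet> (X *v (v + w)) = v \<bullet> (X *v v) + 2 * (v \<bullet> (X *v w)) + w \<bullet> (X *v w)"
  using sym_inner_swap[OF assms, of v w]
  by (simp add: matrix_vector_right_distrib inner_add_left inner_add_right)

lemma trace_nonneg: "psd X \<Longrightarrow> 0 \<le> trace X"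
  by (auto simp: trace_def psd_def entry_eq_inner intro!: sum_nonneg)

lemma trace_mono: "X \<preceq> Y \<Longrightarrow> trace X \<le> trace Y"
  using trace_nonneg[of "Y - X"] by (simp add: loewner_le_def trace_sub)

text \<open>The form is nonnegative at the sum and the difference of two unit vectors, so twice the
  modulus of an entry is at most the sum of two diagonal entries.\<close>

lemma psd_entry_le_trace:
  assumes "psd X"
  shows "\<bar>X $ i $ j\<bar> \<le> trace X"
proof -
  let ?a = "axis i 1 :: real ^ 'a" and ?b = "axis j 1 :: real ^ 'a"
  have sym: "transpose X = X" and pos: "\<And>v. 0 \<le> v \<bullet> (X *v v)"
    using assms by (auto simp: psd_def)
  have diag: "X $ k $ k \<le> trace X" for k
    unfolding trace_def by (rule member_le_sum) (auto simp: entry_eq_inner pos)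
  have "X *v (- ?b) = - (X *v ?b)"
    by (metis matrix_vector_mul_linear linear_neg)
  then show ?thesis
    using pos[of "?a + ?b"] pos[of "?a + (- ?b)"] diag[of i] diag[of j]
    unfolding inner_sum_quadratic[OF sym] by (simp add: entry_eq_inner)
qed

lemma psd_trace_0: "psd X \<Longrightarrow> trace X = 0 \<Longrightarrow> X = 0"
  using psd_entry_le_trace[of X] by (simp add: vec_eq_iff)

lemma trace_pos: "psd X \<Longrightarrow> X \<noteq> 0 \<Longrightarrow> 0 < trace X"
  using trace_nonneg[of X] psd_trace_0[of X] by force

lemma pos_def_trace_pos:
  assumes "pos_def X"
  shows "0 < trace X"
proof (intro trace_pos pos_def_imp_psd assms notI)
  assume "X = 0"
  then show False
    using assms by (metis inner_zero_right less_irrefl matrix_vector_mult_0 pos_def_def zero_neq_one)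
qed

lemma loewner_le_antisym:
  assumes "X \<preceq> Y" "Y \<preceq> X"
  shows "X = Y"
  using psd_trace_0[of "Y - X"] trace_mono[OF assms(1)] trace_mono[OF assms(2)] assms(1)
  by (simp add: loewner_le_def trace_sub)

text \<open>A crude termwise bound on the double sum; only the independence of the constant from
  \<open>X\<close> matters.\<close>

lemma psd_quadratic_le_trace:
  fixes X :: "real ^ 'n ^ 'n"
  assumes "psd X"
  shows "v \<bullet> (X *v v) \<le> (real CARD('n))\<^sup>2 * trace X * (v \<bullet> v)"
proof -
  have "v \<bullet> (X *v v) = (\<Sum>i\<in>UNIV. \<Sum>j\<in>UNIV. v $ i * (X $ i $ j * v $ j))"
    by (simp add: inner_vec_def matrix_vector_mult_def sum_distrib_left)
  also have "\<dots> \<le> (\<Sum>i\<in>(UNIV :: 'n set). \<Sum>j\<in>(UNIV :: 'n set). norm v * (trace X * norm v))"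
  proof (intro sum_mono)
    fix i j
    have "v $ i * (X $ i $ j * v $ j) \<le> \<bar>v $ i\<bar> * (\<bar>X $ i $ j\<bar> * \<bar>v $ j\<bar>)"
      by (metis abs_ge_self abs_mult)
    also have "\<dots> \<le> norm v * (trace X * norm v)"
      using psd_entry_le_trace[OF assms] trace_nonneg[OF assms]
      by (intro mult_mono) (auto simp: component_le_norm_cart)
    finally show "v $ i * (X $ i $ j * v $ j) \<le> norm v * (trace X * norm v)" .
  qed
  finally show ?thesis
    by (simp add: power2_eq_square dot_square_norm mult_ac)
qed

text \<open>The form attains a positive minimum on the compact unit sphere; homogeneity of degree
  two does the rest.\<close>

lemma pos_def_quadratic_ge:
  fixes X :: "real ^ 'n ^ 'n"
  assumes "pos_def X"
  obtains c where "0 < c" "\<And>v. c * (v \<bullet> v) \<le> v \<bullet> (X *v v)"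
proof -
  let ?S = "sphere 0 1 :: (real ^ 'n) set"
  have "continuous_on ?S (\<lambda>v. v \<bullet> (X *v v))"
    by (intro continuous_intros linear_continuous_on matrix_vector_mul_bounded_linear)
  moreover have "axis undefined 1 \<in> ?S"
    by (simp add: norm_axis_1)
  ultimately obtain u where u: "u \<in> ?S" "\<And>v. v \<in> ?S \<Longrightarrow> u \<bullet> (X *v u) \<le> v \<bullet> (X *v v)"
    using continuous_attains_inf[of ?S "\<lambda>v. v \<bullet> (X *v v)"] by auto
  show ?thesis
  proof
    show "0 < u \<bullet> (X *v u)"
      using assms u(1) by (metis dist_0_norm mem_sphere norm_zero pos_def_def zero_neq_one)
    show "u \<bullet> (X *v u) * (v \<bullet> v) \<le> v \<bullet> (X *v v)" for v
    proof (cases "v = 0")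
      case False
      define w where "w = v /\<^sub>R norm v"
      have v: "v = norm v *\<^sub>R w" and w: "w \<in> ?S"
        using False by (auto simp: w_def)
      have "v \<bullet> (X *v v) = (norm v)\<^sup>2 * (w \<bullet> (X *v w))"
        by (subst (1 2) v) (simp add: matrix_vector_mult_scaleR power2_eq_square)
      then show ?thesis
        using mult_left_mono[OF u(2)[OF w], of "(norm v)\<^sup>2"]
        by (simp add: dot_square_norm mult.commute)
    qed simp
  qed
qed

text \<open>Since \<open>D\<close> is uniform in \<open>Y\<close>, a gap with small trace lies below
  a small multiple of \<open>P\<close>.\<close>

lemma psd_le_pos_def_trace:
  fixes P :: "real ^ 'n ^ 'n"
  assumes "pos_def P"
  obtains D where "0 < D" "\<And>Y. psd Y \<Longrightarrow> Y \<preceq> (D * trace Y) *\<^sub>R P"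
proof -
  obtain c where c: "0 < c" "\<And>v. c * (v \<bullet> v) \<le> v \<bullet> (P *v v)"
    using pos_def_quadratic_ge[OF assms] by blast
  show ?thesis
  proof
    show "0 < (real CARD('n))\<^sup>2 / c" using c(1) by simp
    fix Y :: "real ^ 'n ^ 'n" assume Y: "psd Y"
    show "Y \<preceq> ((real CARD('n))\<^sup>2 / c * trace Y) *\<^sub>R P"
    proof (rule loewner_leI)
      fix v
      have "v \<bullet> (Y *v v) \<le> (real CARD('n))\<^sup>2 * trace Y * (v \<bullet> v)"
        by (rule psd_quadratic_le_trace[OF Y])
      also have "\<dots> = (real CARD('n))\<^sup>2 / c * trace Y * (c * (v \<bullet> v))"
        using c(1) by simp
      also have "\<dots> \<le> (real CARD('n))\<^sup>2 / c * trace Y * (v \<bullet> (P *v v))"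
        using c trace_nonneg[OF Y] by (intro mult_left_mono) auto
      finally show "v \<bullet> (Y *v v) \<le> v \<bullet> ((((real CARD('n))\<^sup>2 / c * trace Y) *\<^sub>R P) *v v)"
        by (simp add: scaleR_mult_vec)
    qed (use Y assms in \<open>auto simp: psd_def pos_def_def transpose_scalar\<close>)
  qed
qed

lemma pos_def_ge_pos_def:
  fixes W P :: "real ^ 'n ^ 'n"
  assumes "pos_def W" "pos_def P"
  obtains c where "0 < c" "c *\<^sub>R P \<preceq> W"
proof -
  obtain D where D: "0 < D" "P \<preceq> (D * trace P) *\<^sub>R W"
    using psd_le_pos_def_trace[OF assms(1)] pos_def_imp_psd[OF assms(2)] by blast
  have "0 < D * trace P"
    by (intro mult_pos_pos D(1) pos_def_trace_pos assms(2))
  moreover from this have "(1 / (D * trace P)) *\<^sub>R P \<preceq> W"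
    using loewner_le_scaleR[OF D(2), of "1 / (D * trace P)"] by (auto split: if_splits)
  ultimately show ?thesis
    using that[of "1 / (D * trace P)"] by simp
qed

lemma pos_def_scaleR_le:
  fixes P :: "real ^ 'n ^ 'n"
  assumes "pos_def P" "a *\<^sub>R P \<preceq> b *\<^sub>R P"
  shows "a \<le> b"
proof -
  obtain v :: "real ^ 'n" where "v \<noteq> 0"
    by (metis vec_eq_iff one_index zero_index zero_neq_one)
  then have "0 < v \<bullet> (P *v v)"
    using assms(1) by (simp add: pos_def_def)
  then show ?thesis
    using loewner_leD[OF assms(2), of v] by (simp add: scaleR_mult_vec)
qed

section \<open>Bounds for the Hilbert metric\<close>

lemma hilbert_dist_bounds:
  fixes P :: "real ^ 'n ^ 'n"
  assumes P: "pos_def P" and "a *\<^sub>R P \<preceq> X" "X \<preceq> b *\<^sub>R P" and a: "0 < a"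
  shows "0 \<le> hilbert_dist X P" "hilbert_dist X P \<le> ereal (ln (b / a))"
proof -
  have le: "u \<le> l" if "u *\<^sub>R P \<preceq> X" "X \<preceq> l *\<^sub>R P" for u l
    using pos_def_scaleR_le[OF P loewner_le_trans[OF that]] .
  define M m where "M = hilbert_M X P" and "m = hilbert_m X P"
  \<comment> \<open>\<open>a\<close> and \<open>b\<close> belong to the sets defining
    \<open>m\<close> and \<open>M\<close>, and every lower factor is below every upper one. Hence
    both values are finite and positive.\<close>
  have "M \<le> ereal b" "ereal a \<le> m" "m \<le> M"
    using assms(2,3) le unfolding M_def m_def hilbert_M_def hilbert_m_def
    by (auto intro!: INF_lower SUP_upper INF_greatest SUP_least)
  then obtain M' m' where M': "M = ereal M'" and m': "m = ereal m'"
    and *: "a \<le> m'" "m' \<le> M'" "M' \<le> b"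
    by (cases M; cases m; force)
  have d: "hilbert_dist X P = ereal (ln (M' / m'))"
    using * a M' m' unfolding hilbert_dist_def M_def m_def by auto
  have "M' / m' \<le> b / a"
    using * a by (intro frac_le) auto
  moreover have "1 \<le> M' / m'"
    using * a by simp
  ultimately show "0 \<le> hilbert_dist X P" "hilbert_dist X P \<le> ereal (ln (b / a))"
    unfolding d by (auto simp: ln_ge_zero)
qed

section \<open>Inverses, congruences and the rank conditions\<close>

lemma matrix_inv_mult:
  fixes S :: "real ^ 'n ^ 'n"
  assumes "invertible S"
  shows "S ** matrix_inv S = mat 1" "matrix_inv S ** S = mat 1"
  using someI_ex[OF assms[unfolded invertible_def]] by (auto simp: matrix_inv_def)

lemma pos_def_invertible: "pos_def S \<Longrightarrow> invertible S"
  unfolding invertible_left_inverse matrix_left_invertible_ker pos_def_def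
  by (metis inner_zero_right less_irrefl)

lemma transpose_matrix_inv:
  fixes S :: "real ^ 'n ^ 'n"
  assumes "invertible S" "transpose S = S"
  shows "transpose (matrix_inv S) = matrix_inv S"
proof -
  have "transpose (matrix_inv S) ** S = mat 1"
    by (metis assms matrix_inv_mult(1) matrix_transpose_mul transpose_mat)
  then show ?thesis
    by (metis assms(1) matrix_inv_mult(1) matrix_mul_assoc matrix_mul_lid matrix_mul_rid)
qed

lemma psd_congruence:
  fixes X :: "real ^ 'n ^ 'n" and M :: "real ^ 'm ^ 'n"
  assumes "psd X"
  shows "psd (transpose M ** X ** M)"
  using assms
  by (simp add: psd_def matrix_transpose_mul matrix_mul_assoc flip: matrix_vector_mul_assoc)
     (simp add: inner_transpose_mult)

lemma psd_gram: "psd (transpose M ** M)" for M :: "real ^ 'n ^ 'm"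
  by (simp add: psd_def matrix_transpose_mul inner_transpose_mult flip: matrix_vector_mul_assoc)

lemma mat_power_commute: "mat_power A k ** A = A ** mat_power A k"
  by (induction k) (simp_all flip: matrix_mul_assoc)

lemma mat_power_Suc_vec: "mat_power A (Suc k) *v v = mat_power A k *v (A *v v)"
  by (simp add: matrix_vector_mul_assoc mat_power_commute)

text \<open>Full column rank of the stacked matrix is used as injectivity.\<close>

lemma observableD:
  fixes A :: "real ^ 'n ^ 'n" and C :: "real ^ 'n ^ 'm"
  assumes "observable A C" and *: "\<And>k. k < CARD('n) \<Longrightarrow> C *v (mat_power A k *v v) = 0"
  shows "v = 0"
proof -
  have "to_nat_on (UNIV :: 'n set) i < CARD('n)" for i
    using bij_betwE[OF to_nat_on_finite[of "UNIV :: 'n set"]] by auto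
  moreover have "(observability_matrix A C *v v) $ r
      = (C *v (mat_power A (to_nat_on (UNIV :: 'n set) (fst r)) *v v)) $ snd r" for r
    unfolding matrix_vector_mul_assoc
    by (simp add: observability_matrix_def matrix_vector_mult_def)
  ultimately have "(observability_matrix A C *v v) $ r = 0" for r
    using * by simp
  then have "observability_matrix A C *v v = observability_matrix A C *v 0"
    by (simp add: vec_eq_iff)
  then show ?thesis
    using assms(1) unfolding observable_def full_rank_injective by (metis injD)
qed

text \<open>Full row rank is used as surjectivity: a preimage of \<open>w\<close>, cut into blocks,
  gives the controls.\<close>

lemma controllableD:
  fixes A :: "real ^ 'n ^ 'n" and B :: "real ^ 'p ^ 'n"
  assumes "controllable A B"
  obtains z where "w = (\<Sum>k<CARD('n). mat_power A k *v (B *v z k))"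
proof -
  let ?f = "to_nat_on (UNIV :: 'n set)"
  have bij: "bij_betw ?f UNIV {..<CARD('n)}"
    by (rule to_nat_on_finite) simp
  obtain y where y: "w = controllability_matrix A B *v y"
    using assms unfolding controllable_def full_rank_surjective by (metis surjD)
  \<comment> \<open>The inverse of the block numbering recovers the block that belongs to the power
    \<open>k\<close>.\<close>
  define z where "z k = (\<chi> p. y $ (inv_into UNIV ?f k, p))" for k
  have z: "z (?f i) $ p = y $ (i, p)" for i p
    using bij by (simp add: z_def bij_betw_def)
  have "w = (\<Sum>i\<in>UNIV. mat_power A (?f i) *v (B *v z (?f i)))"
    unfolding vec_eq_iff y matrix_vector_mul_assoc
    by (simp add: controllability_matrix_def matrix_vector_mult_def z
        sum.cartesian_product case_prod_beta flip: UNIV_Times_UNIV)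
  also have "\<dots> = (\<Sum>k<CARD('n). mat_power A k *v (B *v z k))"
    by (rule sum.reindex_bij_betw[OF bij])
  finally show ?thesis
    using that by blast
qed

section \<open>The Riccati map\<close>

locale riccati =
  fixes A :: "real ^ 'n ^ 'n" and B :: "real ^ 'p ^ 'n" and C :: "real ^ 'n ^ 'm"
    and R :: "real ^ 'p ^ 'p"
  assumes pos_def_R: "pos_def R"
begin

definition ric :: "real \<Rightarrow> real ^ 'n ^ 'n \<Rightarrow> real ^ 'n ^ 'n" where
  "ric r X = transpose A
       ** (X - X ** B ** matrix_inv (r *\<^sub>R R + transpose B ** X ** B) ** transpose B ** X)
       ** A
     + r *\<^sub>R (transpose C ** C)"

text \<open>One stage of the linear-quadratic regulator problem, with \<open>X\<close> as the weight
  on the next state.\<close>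

definition cost :: "real \<Rightarrow> real ^ 'n ^ 'n \<Rightarrow> real ^ 'n \<Rightarrow> real ^ 'p \<Rightarrow> real" where
  "cost r X v u = (A *v v + B *v u) \<bullet> (X *v (A *v v + B *v u))
     + r * (u \<bullet> (R *v u)) + r * ((C *v v) \<bullet> (C *v v))"

text \<open>For \<open>r = 0\<close> and \<open>X = 0\<close> the inverse in \<open>ric\<close> is a junk value, but it is multiplied by \<open>0\<close>.\<close>
definition admissible :: "real \<Rightarrow> real ^ 'n ^ 'n \<Rightarrow> bool" where
  "admissible r X \<longleftrightarrow> psd X \<and> (0 < r \<or> r = 0 \<and> X = 0)"

lemma riccati_step_eq: "riccati_step A B C R \<alpha> X = ric (\<alpha> * trace X) X"
  by (simp add: riccati_step_def ric_def)

lemma dare_iff: "dare A B C R P \<longleftrightarrow> ric 1 P = P"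
proof -
  have "ric 1 P = transpose A ** P ** A
         - transpose A ** P ** B ** matrix_inv (R + transpose B ** P ** B) ** transpose B ** P ** A
         + transpose C ** C"
    unfolding ric_def matrix_eq
    by (simp add: matrix_vector_mult_add_rdistrib matrix_vector_mult_diff_rdistrib
        matrix_vector_right_distrib matrix_vector_mult_diff_distrib flip: matrix_vector_mul_assoc)
  then show ?thesis
    unfolding dare_def by auto
qed

lemma ric_0_0: "ric 0 0 = 0"
  by (simp add: ric_def)

lemma cost_0_0: "cost 0 0 v u = 0"
  by (simp add: cost_def)

lemma R_nonneg: "0 \<le> u \<bullet> (R *v u)"
  using pos_def_imp_psd[OF pos_def_R] by (simp add: psd_def)

lemma pos_def_inner_matrix:
  assumes "psd X" "0 < r"
  shows "pos_def (r *\<^sub>R R + transpose B ** X ** B)"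
proof -
  have "0 < v \<bullet> ((r *\<^sub>R R + transpose B ** X ** B) *v v)" if "v \<noteq> 0" for v
  proof -
    have "0 < v \<bullet> (R *v v)"
      using that pos_def_R by (simp add: pos_def_def)
    moreover have "0 \<le> v \<bullet> ((transpose B ** X ** B) *v v)"
      using psd_congruence[OF assms(1), of B] by (simp only: psd_def)
    ultimately show ?thesis
      using assms(2)
      by (simp only: matrix_vector_mult_add_rdistrib inner_add_right scaleR_mult_vec)
         (simp add: add_pos_nonneg)
  qed
  then show ?thesis
    using pos_def_R psd_congruence[OF assms(1), of B]
    by (simp add: pos_def_def psd_def transpose_add transpose_scalar)
qed

text \<open>Completing the square in the control \<open>u\<close>.\<close>
lemma cost_eq_ric:
  assumes "psd X" "0 < r"
  obtains S u0 where "pos_def S"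
    "\<And>u. cost r X v u = v \<bullet> (ric r X *v v) + (u + u0) \<bullet> (S *v (u + u0))"
proof -
  define S where "S = r *\<^sub>R R + transpose B ** X ** B"
  have S: "pos_def S"
    unfolding S_def by (rule pos_def_inner_matrix[OF assms])
  have symX: "transpose X = X" and symS: "transpose S = S"
    using assms S by (auto simp: psd_def pos_def_def)
  define w where "w = A *v v"
  define b where "b = transpose B *v (X *v w)"
  \<comment> \<open>The minimising control is \<open>- u0\<close>; the equation
    \<open>S *v u0 = b\<close> absorbs the cross term into the square.\<close>
  define u0 where "u0 = matrix_inv S *v b"
  have Su0: "S *v u0 = b"
    by (simp add: u0_def matrix_vector_mul_assoc matrix_inv_mult pos_def_invertible S)
  have ric: "v \<bullet> (ric r X *v v) = w \<bullet> (X *v w) - b \<bullet> u0 + r * ((C *v v) \<bullet> (C *v v))"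
  proof -
    have "w \<bullet> (X *v (B *v u0)) = b \<bullet> u0"
      unfolding b_def by (metis inner_commute inner_transpose_mult symX)
    then show ?thesis
      by (simp add: ric_def matrix_vector_mult_add_rdistrib matrix_vector_mult_diff_rdistrib
          inner_add_right inner_diff_right inner_transpose_mult scaleR_mult_vec
          flip: matrix_vector_mul_assoc S_def w_def b_def u0_def)
  qed
  have "cost r X v u = v \<bullet> (ric r X *v v) + (u + u0) \<bullet> (S *v (u + u0))" for u
  proof -
    have 1: "w \<bullet> (X *v (B *v u)) = b \<bullet> u"
      unfolding b_def by (metis inner_commute inner_transpose_mult symX)
    have 2: "u \<bullet> (S *v u) = r * (u \<bullet> (R *v u)) + (B *v u) \<bullet> (X *v (B *v u))"
      by (simp add: S_def matrix_vector_mult_add_rdistrib inner_add_right inner_transpose_mult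
          scaleR_mult_vec flip: matrix_vector_mul_assoc)
    show ?thesis
      unfolding cost_def ric w_def[symmetric] inner_sum_quadratic[OF symX] inner_sum_quadratic[OF symS]
        1 2 Su0 by (simp add: inner_commute)
  qed
  with S show ?thesis
    using that by blast
qed

text \<open>Together with \<open>ric_attained\<close> this is the variational characterisation of
  \<open>ric\<close> from which its order properties follow.\<close>

lemma ric_le_cost:
  assumes "admissible r X"
  shows "v \<bullet> (ric r X *v v) \<le> cost r X v u"
proof (cases "0 < r")
  case True
  then obtain S u0 where S: "pos_def S"
    and *: "cost r X v u = v \<bullet> (ric r X *v v) + (u + u0) \<bullet> (S *v (u + u0))"
    using cost_eq_ric[of X r v] assms by (metis admissible_def)
  show ?thesis
    using * pos_def_imp_psd[OF S] by (simp add: psd_def)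
qed (use assms in \<open>simp add: admissible_def ric_0_0 cost_0_0\<close>)

lemma ric_attained:
  assumes "admissible r X"
  obtains u where "v \<bullet> (ric r X *v v) = cost r X v u"
proof (cases "0 < r")
  case True
  then obtain S u0 where
    "\<And>u. cost r X v u = v \<bullet> (ric r X *v v) + (u + u0) \<bullet> (S *v (u + u0))"
    using cost_eq_ric[of X r v] assms by (metis admissible_def)
  then have "v \<bullet> (ric r X *v v) = cost r X v (- u0)"
    by simp
  then show ?thesis using that by blast
qed (use assms that in \<open>auto simp: admissible_def ric_0_0 cost_0_0\<close>)

lemma transpose_ric:
  assumes "admissible r X"
  shows "transpose (ric r X) = ric r X"
proof (cases "0 < r")
  case True
  define T where "T = matrix_inv (r *\<^sub>R R + transpose B ** X ** B)"
  have X: "psd X" "transpose X = X"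
    using assms by (auto simp: admissible_def psd_def)
  have T: "transpose T = T"
    using pos_def_inner_matrix[OF X(1) True] unfolding T_def
    by (intro transpose_matrix_inv pos_def_invertible) (auto simp: pos_def_def)
  show ?thesis
    unfolding ric_def T_def[symmetric]
    by (simp add: transpose_add transpose_diff transpose_scalar matrix_transpose_mul X T
        matrix_mul_assoc)
next
  case False
  then show ?thesis
    using assms psd_0 by (simp add: admissible_def ric_0_0 psd_def del: psd_0)
qed

lemma cost_nonneg: "admissible r X \<Longrightarrow> 0 \<le> cost r X v u"
  using R_nonneg by (auto simp: admissible_def psd_def cost_def)

lemma psd_ric:
  assumes "admissible r X"
  shows "psd (ric r X)"
  unfolding psd_def
  using transpose_ric[OF assms] ric_attained[OF assms] cost_nonneg[OF assms] by metis

text \<open>The cost is additive in the pair of weight and matrix, and an optimal control for the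
  sum is a candidate for each summand.\<close>

lemma ric_superadditive:
  assumes "admissible r X" "admissible s Y"
  shows "ric r X + ric s Y \<preceq> ric (r + s) (X + Y)"
proof -
  have adm: "admissible (r + s) (X + Y)"
    using assms by (auto simp: admissible_def psd_add)
  show ?thesis
  proof (rule loewner_leI)
    fix v
    obtain u where "v \<bullet> (ric (r + s) (X + Y) *v v) = cost (r + s) (X + Y) v u"
      using ric_attained[OF adm] .
    also have "\<dots> = cost r X v u + cost s Y v u"
      by (simp add: cost_def matrix_vector_mult_add_rdistrib inner_add_right algebra_simps)
    finally show "v \<bullet> ((ric r X + ric s Y) *v v) \<le> v \<bullet> (ric (r + s) (X + Y) *v v)"
      using ric_le_cost[OF assms(1), of v u] ric_le_cost[OF assms(2), of v u]
      by (simp add: matrix_vector_mult_add_rdistrib inner_add_right)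
  qed (use transpose_ric assms adm in \<open>auto simp: transpose_add\<close>)
qed

text \<open>An optimal control for the larger pair costs no more under the smaller one.\<close>

lemma ric_mono:
  assumes "admissible r X" "admissible s Y" "r \<le> s" "X \<preceq> Y"
  shows "ric r X \<preceq> ric s Y"
proof (rule loewner_leI)
  fix v
  obtain u where "v \<bullet> (ric s Y *v v) = cost s Y v u"
    using ric_attained[OF assms(2)] .
  moreover have "cost r X v u \<le> cost s Y v u"
    unfolding cost_def using assms(3) loewner_leD[OF assms(4)] R_nonneg
    by (intro add_mono mult_right_mono) auto
  ultimately show "v \<bullet> (ric r X *v v) \<le> v \<bullet> (ric s Y *v v)"
    using ric_le_cost[OF assms(1), of v u] by simp
qed (use transpose_ric assms in auto)

text \<open>The cost scales by \<open>c\<close>, hence so does its minimum; \<open>c = 0\<close> is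
  the degenerate admissible pair.\<close>

lemma ric_scaleR:
  assumes "admissible r X" "0 \<le> c"
  shows "ric (c * r) (c *\<^sub>R X) = c *\<^sub>R ric r X"
proof (cases "c = 0")
  case False
  then have adm: "admissible (c * r) (c *\<^sub>R X)"
    using assms by (auto simp: admissible_def psd_scaleR)
  have cost: "cost (c * r) (c *\<^sub>R X) v u = c * cost r X v u" for v u
    by (simp add: cost_def scaleR_mult_vec algebra_simps)
  have q: "v \<bullet> ((c *\<^sub>R ric r X) *v v) = c * (v \<bullet> (ric r X *v v))" for v
    by (simp add: scaleR_mult_vec)
  show ?thesis
  proof (rule loewner_le_antisym; rule loewner_leI)
    fix v
    obtain u where "v \<bullet> (ric r X *v v) = cost r X v u"
      using ric_attained[OF assms(1)] .
    then show "v \<bullet> (ric (c * r) (c *\<^sub>R X) *v v) \<le> v \<bullet> ((c *\<^sub>R ric r X) *v v)"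
      using ric_le_cost[OF adm, of v u] by (simp add: q cost)
    obtain u where "v \<bullet> (ric (c * r) (c *\<^sub>R X) *v v) = cost (c * r) (c *\<^sub>R X) v u"
      using ric_attained[OF adm] .
    then show "v \<bullet> ((c *\<^sub>R ric r X) *v v) \<le> v \<bullet> (ric (c * r) (c *\<^sub>R X) *v v)"
      using mult_left_mono[OF ric_le_cost[OF assms(1), of v u] assms(2)] by (simp add: q cost)
  qed (use transpose_ric adm assms in \<open>auto simp: transpose_scalar\<close>)
qed (simp add: ric_0_0)

lemma admissibleI: "psd X \<Longrightarrow> 0 < r \<Longrightarrow> admissible r X"
  by (simp add: admissible_def)

section \<open>Iterates with a fixed weight\<close>

lemma psd_ric_iterate: "0 < r \<Longrightarrow> psd X \<Longrightarrow> psd ((ric r ^^ k) X)"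
  by (induction k) (auto intro: psd_ric admissibleI)

lemma ric_iterate_mono:
  assumes "0 < r" "psd X" "X \<preceq> Y"
  shows "(ric r ^^ k) X \<preceq> (ric r ^^ k) Y"
proof (induction k)
  case (Suc k)
  then show ?case
    using assms psd_mono[OF assms(2,3)] by (auto intro!: ric_mono admissibleI psd_ric_iterate)
qed (use assms in simp)

lemma ric_iterate_scaleR:
  assumes "0 < r" "0 < c" "psd X"
  shows "(ric (c * r) ^^ k) (c *\<^sub>R X) = c *\<^sub>R (ric r ^^ k) X"
  by (induction k) (use assms in \<open>auto simp: ric_scaleR admissibleI psd_ric_iterate\<close>)

lemma ric_iterate_superadditive:
  assumes "0 < r" "0 < s" "psd X" "psd Y"
  shows "(ric r ^^ k) X + (ric s ^^ k) Y \<preceq> (ric (r + s) ^^ k) (X + Y)"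
proof (induction k)
  case (Suc k)
  let ?X = "(ric r ^^ k) X" and ?Y = "(ric s ^^ k) Y"
  have psd: "psd ?X" "psd ?Y" "psd ((ric (r + s) ^^ k) (X + Y))"
    using assms by (auto intro: psd_ric_iterate psd_add)
  have "ric r ?X + ric s ?Y \<preceq> ric (r + s) (?X + ?Y)"
    using assms psd by (intro ric_superadditive admissibleI)
  also have "\<dots> \<preceq> ric (r + s) ((ric (r + s) ^^ k) (X + Y))"
    using assms psd Suc by (intro ric_mono admissibleI psd_add) auto
  finally show ?case by simp
qed simp

text \<open>Zero optimal cost over \<open>N\<close> stages forces every control to vanish, as
  \<open>R\<close> is positive definite, and then every output of the free trajectory.\<close>

lemma ric_iterate_0_eq_0_imp:
  assumes "0 < r" "v \<bullet> ((ric r ^^ N) 0 *v v) = 0" "k < N"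
  shows "C *v (mat_power A k *v v) = 0"
  using assms(2,3)
proof (induction N arbitrary: v k)
  case (Suc N)
  let ?X = "(ric r ^^ N) 0"
  have X: "psd ?X"
    using assms(1) by (simp add: psd_ric_iterate)
  obtain u where u: "cost r ?X v u = 0"
    using ric_attained[OF admissibleI[OF X assms(1)], of v] Suc.prems(1) by auto
  let ?y = "A *v v + B *v u"
  have "0 \<le> ?y \<bullet> (?X *v ?y)" "0 \<le> r * (u \<bullet> (R *v u))" "0 \<le> r * ((C *v v) \<bullet> (C *v v))"
    using X R_nonneg assms(1) by (auto simp: psd_def)
  with u have "?y \<bullet> (?X *v ?y) = 0" "r * (u \<bullet> (R *v u)) = 0" "r * ((C *v v) \<bullet> (C *v v)) = 0"
    unfolding cost_def by linarith+
  moreover from this(2) have "u = 0"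
    using assms(1) pos_def_R by (metis less_irrefl mult_eq_0_iff pos_def_def)
  ultimately have "(A *v v) \<bullet> (?X *v (A *v v)) = 0" "C *v v = 0"
    using assms(1) by auto
  \<comment> \<open>The remaining \<open>N\<close> stages start at \<open>A *v v\<close>, so output
    \<open>k\<close> becomes output \<open>k - 1\<close> there.\<close>
  then show ?case
    using Suc.IH[of "A *v v" "k - 1"] Suc.prems(2)
    by (cases k) (auto simp: mat_power_Suc_vec simp del: mat_power.simps(2))
qed simp

lemma pos_def_ric_iterate_0:
  assumes "observable A C" "0 < r"
  shows "pos_def ((ric r ^^ CARD('n)) 0)"
proof -
  have "psd ((ric r ^^ CARD('n)) 0)"
    using assms(2) by (simp add: psd_ric_iterate)
  moreover have "v = 0" if "v \<bullet> ((ric r ^^ CARD('n)) 0 *v v) = 0" for v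
    using observableD[OF assms(1)] ric_iterate_0_eq_0_imp[OF assms(2) that] by blast
  ultimately show ?thesis
    unfolding pos_def_def psd_def by (metis less_eq_real_def)
qed

section \<open>The Riccati equation\<close>

text \<open>Used with both orders of two solutions, this gives uniqueness by antisymmetry.\<close>

lemma ric_fixed_le:
  assumes obs: "observable A C" and P: "pos_def P" "ric 1 P = P" and Q: "pos_def Q" "ric 1 Q = Q"
  shows "P \<preceq> Q"
proof -
  let ?N = "CARD('n)"
  let ?W = "(ric 1 ^^ ?N) 0"
  have fix1: "(ric 1 ^^ k) X = X" if "ric 1 X = X" for k X
    by (induction k) (use that in auto)
  have psdP: "psd P"
    using P by (simp add: pos_def_imp_psd)
  obtain c0 where c0: "0 < c0" "c0 *\<^sub>R P \<preceq> ?W"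
    using pos_def_ge_pos_def[OF pos_def_ric_iterate_0[OF obs, of 1] P(1)] by auto
  \<comment> \<open>The cap at \<open>1 / 2\<close> gives \<open>c < 1\<close>, so the factors
    reached below stay strictly between 0 and 1, as \<open>step\<close> requires.\<close>
  define c where "c = min c0 (1 / 2)"
  have c: "0 < c" "c < 1" "c *\<^sub>R P \<preceq> ?W"
    using c0 loewner_le_trans[OF loewner_le_scaleR_right[OF psdP, of c c0]] by (auto simp: c_def)
  \<comment> \<open>The gap \<open>1 - t\<close> shrinks by the factor \<open>1 - c\<close>. The
    weight 1 is split into \<open>t\<close>, for which \<open>t P\<close> is stationary, and
    \<open>1 - t\<close>, whose iterates from 0 give \<open>(1 - t) W\<close>.\<close>
  have step: "(1 - (1 - c) * (1 - t)) *\<^sub>R P \<preceq> Q" if t: "0 < t" "t < 1" "t *\<^sub>R P \<preceq> Q" for t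
  proof -
    have "(1 - (1 - c) * (1 - t)) *\<^sub>R P = t *\<^sub>R P + (1 - t) *\<^sub>R (c *\<^sub>R P)"
      by (simp add: algebra_simps)
    also have "\<dots> \<preceq> t *\<^sub>R P + (1 - t) *\<^sub>R ?W"
      using t c by (intro loewner_le_add loewner_le_scaleR) auto
    also have "\<dots> = (ric t ^^ ?N) (t *\<^sub>R P) + (ric (1 - t) ^^ ?N) 0"
      using ric_iterate_scaleR[of 1 t P ?N] ric_iterate_scaleR[of 1 "1 - t" 0 ?N] t psdP
        fix1[OF P(2)] by simp
    also have "\<dots> \<preceq> (ric 1 ^^ ?N) (t *\<^sub>R P)"
      using ric_iterate_superadditive[of t "1 - t" "t *\<^sub>R P" 0 ?N] t psdP by (simp add: psd_scaleR)
    also have "\<dots> \<preceq> (ric 1 ^^ ?N) Q"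
      using t psdP by (intro ric_iterate_mono) (auto simp: psd_scaleR)
    finally show ?thesis
      by (simp add: fix1 Q)
  qed
  have "?W \<preceq> (ric 1 ^^ ?N) Q"
    using Q by (intro ric_iterate_mono) (auto simp: pos_def_imp_psd simp flip: psd_iff_loewner)
  then have base: "c *\<^sub>R P \<preceq> Q"
    using c(3) by (auto simp: fix1 Q intro: loewner_le_trans)
  have iter: "(1 - (1 - c) ^ Suc k) *\<^sub>R P \<preceq> Q" for k
  proof (induction k)
    case (Suc k)
    have "(1 - c) ^ Suc k < 1"
      using c by (intro power_Suc_less_one) auto
    then show ?case
      using step[of "1 - (1 - c) ^ Suc k"] c Suc by simp
  qed (use base in simp)
  show ?thesis
  proof (rule loewner_leI)
    fix v
    have "(\<lambda>k. (1 - (1 - c) ^ Suc k) * (v \<bullet> (P *v v))) \<longlonglongrightarrow> (1 - 0) * (v \<bullet> (P *v v))"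
      using c by (intro tendsto_intros LIMSEQ_Suc[OF LIMSEQ_power_zero]) auto
    moreover have "(1 - (1 - c) ^ Suc k) * (v \<bullet> (P *v v)) \<le> v \<bullet> (Q *v v)" for k
      using loewner_leD[OF iter[of k], of v] by (simp only: scaleR_mult_vec inner_scaleR_right)
    ultimately show "v \<bullet> (P *v v) \<le> v \<bullet> (Q *v v)"
      by (intro LIMSEQ_le_const2) auto
  qed (use P Q in \<open>auto simp: pos_def_def\<close>)
qed

text \<open>Steering \<open>x\<close> to \<open>0\<close> in \<open>N\<close> steps has a finite cost that does not depend on the horizon.\<close>
lemma ric_iterate_0_bounded_steerable:
  assumes "mat_power A N *v x + (\<Sum>k<N. mat_power A k *v (B *v z k)) = 0"
  shows "\<exists>K. \<forall>k. x \<bullet> ((ric 1 ^^ (k + N)) 0 *v x) \<le> K"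
  using assms
proof (induction N arbitrary: x)
  case (Suc N)
  \<comment> \<open>\<open>z k\<close> is paired with the power \<open>k\<close> of
    \<open>A\<close>, so the control of highest index acts first.\<close>
  let ?y = "A *v x + B *v z N"
  have "mat_power A N *v ?y + (\<Sum>k<N. mat_power A k *v (B *v z k)) = 0"
    using Suc.prems
    by (simp add: mat_power_Suc_vec matrix_vector_right_distrib algebra_simps del: mat_power.simps(2))
  then obtain K where K: "?y \<bullet> ((ric 1 ^^ (k + N)) 0 *v ?y) \<le> K" for k
    using Suc.IH by blast
  have "x \<bullet> ((ric 1 ^^ (k + Suc N)) 0 *v x)
      \<le> K + z N \<bullet> (R *v z N) + (C *v x) \<bullet> (C *v x)" for k
    using ric_le_cost[OF admissibleI[OF psd_ric_iterate[of 1 0 "k + N"]], of 1 x "z N"] K[of k]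
    by (simp add: cost_def)
  then show ?case by blast
qed auto

lemma ric_iterate_0_incseq: "incseq (\<lambda>k. x \<bullet> ((ric 1 ^^ k) 0 *v x))"
proof (intro incseq_SucI loewner_leD)
  fix k
  have "(ric 1 ^^ k) 0 \<preceq> (ric 1 ^^ k) (ric 1 0)"
    by (intro ric_iterate_mono) (auto simp: psd_ric admissibleI simp flip: psd_iff_loewner)
  then show "(ric 1 ^^ k) 0 \<preceq> (ric 1 ^^ Suc k) 0"
    by (simp add: funpow_swap1)
qed

text \<open>By controllability every \<open>x\<close> can be steered to 0 in \<open>n\<close> steps,
  which bounds the increasing values.\<close>

lemma ric_iterate_0_convergent:
  assumes "controllable A B"
  shows "convergent (\<lambda>k. x \<bullet> ((ric 1 ^^ k) 0 *v x))"
proof -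
  let ?N = "CARD('n)"
  obtain z where "- (mat_power A ?N *v x) = (\<Sum>k<?N. mat_power A k *v (B *v z k))"
    by (rule controllableD[OF assms])
  then have "mat_power A ?N *v x + (\<Sum>k<?N. mat_power A k *v (B *v z k)) = 0"
    by (metis add.right_inverse)
  then obtain K where K: "x \<bullet> ((ric 1 ^^ (k + ?N)) 0 *v x) \<le> K" for k
    using ric_iterate_0_bounded_steerable by blast
  have "x \<bullet> ((ric 1 ^^ k) 0 *v x) \<le> K" for k
    using incseqD[OF ric_iterate_0_incseq, of k "k + ?N" x] K[of k] by simp
  then show ?thesis
    using incseq_convergent[OF ric_iterate_0_incseq] by (metis convergentI)
qed

lemma ex_ric_fixed:
  assumes "controllable A B" and obs: "observable A C"
  shows "\<exists>P. pos_def P \<and> ric 1 P = P"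
proof -
  define p where "p k = (ric 1 ^^ k) 0" for k
  have psd_p: "psd (p k)" for k
    by (simp add: p_def psd_ric_iterate)
  then have sym_p: "transpose (p k) = p k" for k
    by (simp add: psd_def)
  have p_Suc: "p (Suc k) = ric 1 (p k)" for k
    by (simp add: p_def)
  have conv: "convergent (\<lambda>k. x \<bullet> (p k *v x))" for x
    unfolding p_def by (rule ric_iterate_0_convergent[OF assms(1)])
  have "convergent (\<lambda>k. p k $ i $ j)" for i j
  proof -
    let ?a = "axis i 1 :: real ^ 'n" and ?b = "axis j 1 :: real ^ 'n"
    define L where "L x = lim (\<lambda>k. x \<bullet> (p k *v x))" for x
    have L: "(\<lambda>k. x \<bullet> (p k *v x)) \<longlonglongrightarrow> L x" for x
      unfolding L_def using conv by (simp add: convergent_LIMSEQ_iff)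
    \<comment> \<open>Polarisation turns convergence of the forms into convergence of the
      entries.\<close>
    have eq: "p k $ i $ j
        = ((?a + ?b) \<bullet> (p k *v (?a + ?b)) - ?a \<bullet> (p k *v ?a) - ?b \<bullet> (p k *v ?b)) / 2" for k
      unfolding inner_sum_quadratic[OF sym_p] by (simp add: entry_eq_inner)
    have "(\<lambda>k. p k $ i $ j) \<longlonglongrightarrow> (L (?a + ?b) - L ?a - L ?b) / 2"
      unfolding eq by (intro tendsto_intros L) simp
    then show ?thesis
      by (rule convergentI)
  qed
  then obtain l where l: "(\<lambda>k. p k $ i $ j) \<longlonglongrightarrow> l i j" for i j
    unfolding convergent_def by metis
  define P where "P = (\<chi> i j. l i j)"
  have entry: "(\<lambda>k. p k $ i $ j) \<longlonglongrightarrow> P $ i $ j" for i j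
    using l by (simp add: P_def)
  have quad: "(\<lambda>k. x \<bullet> (p k *v x)) \<longlonglongrightarrow> x \<bullet> (P *v x)" for x
    unfolding matrix_vector_mult_def inner_vec_def by (auto intro!: tendsto_intros entry)
  have "p k $ i $ j = p k $ j $ i" for k i j
    using arg_cong[OF sym_p, of "\<lambda>M. M $ i $ j" k] by (simp add: transpose_def)
  then have "P $ i $ j = P $ j $ i" for i j
    using entry[of i j] entry[of j i] LIMSEQ_unique by simp
  then have sym: "transpose P = P"
    by (simp add: transpose_def vec_eq_iff)
  have le: "p k \<preceq> P" for k
    by (intro loewner_leI sym sym_p incseq_le[OF _ quad])
       (simp add: p_def ric_iterate_0_incseq)
  have pd: "pos_def P"
    using pos_def_mono[OF pos_def_ric_iterate_0[OF obs, of 1]] le[of "CARD('n)"] by (simp add: p_def)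
  then have adm: "admissible 1 P"
    by (simp add: admissibleI pos_def_imp_psd)
  obtain D where D: "0 < D" "\<And>Y. psd Y \<Longrightarrow> Y \<preceq> (D * trace Y) *\<^sub>R P"
    using psd_le_pos_def_trace[OF pd] by blast
  \<comment> \<open>Chosen so that \<open>(1 - d k) P\<close> lies below \<open>p k\<close>.\<close>
  define d where "d k = D * trace (P - p k)" for k
  have psd_diff: "psd (P - p k)" for k
    using le by (simp add: loewner_le_def)
  have "(\<lambda>k. D * (trace P - trace (p k))) \<longlonglongrightarrow> D * (trace P - trace P)"
    unfolding trace_def by (intro tendsto_intros entry)
  then have d: "d \<longlonglongrightarrow> 0"
    by (simp add: d_def[abs_def] trace_sub)
  have d_nonneg: "0 \<le> d k" for k
    using D(1) trace_nonneg[OF psd_diff] by (simp add: d_def)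
  have "P \<preceq> ric 1 P"
  proof (intro loewner_leI sym transpose_ric adm)
    fix x
    have "x \<bullet> (p (Suc k) *v x) \<le> x \<bullet> (ric 1 P *v x)" for k
      unfolding p_Suc by (intro loewner_leD ric_mono adm admissibleI psd_p le) auto
    then show "x \<bullet> (P *v x) \<le> x \<bullet> (ric 1 P *v x)"
      by (intro LIMSEQ_le_const2[OF LIMSEQ_Suc[OF quad]]) auto
  qed
  \<comment> \<open>Homogeneity replaces continuity of \<open>ric 1\<close>: lowering the weight to
    \<open>1 - d k\<close> gives \<open>(1 - d k) ric 1 P \<preceq> p (Suc k) \<preceq> P\<close>,
    and \<open>d k\<close> tends to 0. The bound holds once \<open>d k < 1\<close>, which makes the
    scaled pair admissible.\<close>
  moreover have "ric 1 P \<preceq> P"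
  proof (intro loewner_leI sym transpose_ric adm)
    fix x
    have "(\<lambda>k. (1 - d k) * (x \<bullet> (ric 1 P *v x))) \<longlonglongrightarrow> (1 - 0) * (x \<bullet> (ric 1 P *v x))"
      by (intro tendsto_intros d)
    moreover have "\<forall>\<^sub>F k in sequentially. (1 - d k) * (x \<bullet> (ric 1 P *v x)) \<le> x \<bullet> (P *v x)"
      using order_tendstoD(2)[OF d zero_less_one]
    proof eventually_elim
      case (elim k)
      have "(1 - d k) *\<^sub>R P \<preceq> p k"
        using D(2)[OF psd_diff, of k] by (simp add: loewner_le_def d_def algebra_simps)
      moreover have "admissible (1 - d k) ((1 - d k) *\<^sub>R P)"
        using elim pd by (simp add: admissible_def psd_scaleR pos_def_imp_psd)
      ultimately have "ric ((1 - d k) * 1) ((1 - d k) *\<^sub>R P) \<preceq> p (Suc k)"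
        unfolding p_Suc using d_nonneg[of k] psd_p[of k] by (intro ric_mono) (auto simp: admissibleI)
      then have "(1 - d k) *\<^sub>R ric 1 P \<preceq> P"
        using elim le[of "Suc k"] by (subst (asm) ric_scaleR[OF adm]) (auto intro: loewner_le_trans)
      from loewner_leD[OF this, of x] show ?case
        by (simp add: scaleR_mult_vec)
    qed
    ultimately show "x \<bullet> (ric 1 P *v x) \<le> x \<bullet> (P *v x)"
      by (intro tendsto_upperbound[where F = sequentially]) auto
  qed
  ultimately show ?thesis
    using pd loewner_le_antisym by blast
qed

section \<open>The trace-weighted iteration\<close>

abbreviation step :: "real \<Rightarrow> real ^ 'n ^ 'n \<Rightarrow> real ^ 'n ^ 'n" where
  "step \<alpha> \<equiv> riccati_step A B C R \<alpha>"

text \<open>A nonzero positive semidefinite matrix has positive trace, so a zero weight arises only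
  at \<open>X = 0\<close>.\<close>

lemma admissible_trace: "psd X \<Longrightarrow> 0 < \<alpha> \<Longrightarrow> admissible (\<alpha> * trace X) X"
  by (cases "X = 0") (auto simp: admissible_def trace_pos, simp add: trace_def)

lemma psd_step_iterate: "0 < \<alpha> \<Longrightarrow> psd X \<Longrightarrow> psd ((step \<alpha> ^^ k) X)"
  by (induction k) (auto simp: riccati_step_eq intro: psd_ric admissible_trace)

text \<open>The trace is additive, so the two weights add up to the weight of the sum.\<close>

lemma step_superadditive:
  assumes "0 < \<alpha>" "psd X" "psd Y"
  shows "step \<alpha> X + step \<alpha> Y \<preceq> step \<alpha> (X + Y)"
  using ric_superadditive[OF admissible_trace[OF assms(2,1)] admissible_trace[OF assms(3,1)]]
  by (simp add: riccati_step_eq trace_add distrib_left)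

lemma step_mono:
  assumes "0 < \<alpha>" "psd X" "X \<preceq> Y"
  shows "step \<alpha> X \<preceq> step \<alpha> Y"
  unfolding riccati_step_eq
  using assms psd_mono[OF assms(2,3)] trace_mono[OF assms(3)]
  by (intro ric_mono admissible_trace) auto

lemma step_iterate_mono:
  assumes "0 < \<alpha>" "psd X" "X \<preceq> Y"
  shows "(step \<alpha> ^^ k) X \<preceq> (step \<alpha> ^^ k) Y"
  by (induction k) (use assms in \<open>auto intro: step_mono psd_step_iterate\<close>)

lemma step_iterate_superadditive:
  assumes "0 < \<alpha>" "psd X" "psd Y"
  shows "(step \<alpha> ^^ k) X + (step \<alpha> ^^ k) Y \<preceq> (step \<alpha> ^^ k) (X + Y)"
proof (induction k)
  case (Suc k)
  let ?X = "(step \<alpha> ^^ k) X" and ?Y = "(step \<alpha> ^^ k) Y"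
  have psd: "psd ?X" "psd ?Y"
    using assms by (auto intro: psd_step_iterate)
  have "step \<alpha> ?X + step \<alpha> ?Y \<preceq> step \<alpha> (?X + ?Y)"
    using assms psd by (intro step_superadditive)
  also have "\<dots> \<preceq> step \<alpha> ((step \<alpha> ^^ k) (X + Y))"
    using assms psd Suc by (intro step_mono psd_add)
  finally show ?case by simp
qed simp

text \<open>The normalisation of \<open>\<alpha>\<close> makes the weight at \<open>a P\<close>
  equal to \<open>a\<close>, and homogeneity applies.\<close>

lemma step_iterate_fixed:
  assumes "psd P" "ric 1 P = P" "\<alpha> * trace P = 1" "0 \<le> a"
  shows "(step \<alpha> ^^ k) (a *\<^sub>R P) = a *\<^sub>R P"
proof -
  have "\<alpha> * trace (a *\<^sub>R P) = a * 1"
    using assms(3) by (simp add: trace_scaleR mult.left_commute)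
  then have "step \<alpha> (a *\<^sub>R P) = a *\<^sub>R P"
    unfolding riccati_step_eq
    using ric_scaleR[OF admissibleI[OF assms(1) zero_less_one] assms(4)] assms(2) by simp
  then show ?thesis
    by (induction k) auto
qed

section \<open>Lower bounds for the trace-weighted iteration\<close>

lemma gram_le_ric:
  assumes "admissible r X"
  shows "r *\<^sub>R (transpose C ** C) \<preceq> ric r X"
proof (rule loewner_leI)
  fix v
  obtain u where "v \<bullet> (ric r X *v v) = cost r X v u"
    using ric_attained[OF assms] .
  \<comment> \<open>Only the output term of the cost is kept.\<close>
  also have "\<dots> \<ge> r * ((C *v v) \<bullet> (C *v v))"
    using assms R_nonneg by (auto simp: cost_def admissible_def psd_def)
  finally show "v \<bullet> ((r *\<^sub>R (transpose C ** C)) *v v) \<le> v \<bullet> (ric r X *v v)"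
    by (simp add: scaleR_mult_vec inner_transpose_mult flip: matrix_vector_mul_assoc)
qed (use transpose_ric[OF assms] in \<open>auto simp: transpose_scalar matrix_transpose_mul\<close>)

text \<open>A vanishing Gram matrix means \<open>C = 0\<close>, which would leave every vector
  unobservable.\<close>

lemma trace_gram_pos:
  assumes "observable A C"
  shows "0 < trace (transpose C ** C)"
proof (intro trace_pos psd_gram notI)
  assume 0: "transpose C ** C = 0"
  have "C *v v = 0" for v
  proof -
    have "(C *v v) \<bullet> (C *v v) = v \<bullet> ((transpose C ** C) *v v)"
      by (simp add: inner_transpose_mult flip: matrix_vector_mul_assoc)
    then show ?thesis by (simp add: 0)
  qed
  then have "(v :: real ^ 'n) = 0" for v
    using observableD[OF assms] by blast
  from this[of 1] show False by simp
qed

lemma step_iterate_lower_bound: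
  assumes obs: "observable A C" and P: "pos_def P" and \<alpha>: "0 < \<alpha>"
  obtains c where "0 < c" "\<And>Y. psd Y \<Longrightarrow> (c * trace Y) *\<^sub>R P \<preceq> (step \<alpha> ^^ CARD('n)) Y"
proof -
  let ?N = "CARD('n)"
  \<comment> \<open>One step multiplies the trace by at least \<open>g\<close>. With
    \<open>g \<le> 1\<close>, the power \<open>g ^ n\<close> is the worst factor over the first
    \<open>n\<close> steps.\<close>
  define g where "g = min 1 (\<alpha> * trace (transpose C ** C))"
  have g: "0 < g" "g \<le> 1"
    using trace_gram_pos[OF obs] \<alpha> by (auto simp: g_def)
  \<comment> \<open>If \<open>Y\<close> has trace \<open>t\<close>, all weights used in the first
    \<open>n\<close> steps are at least \<open>t * \<beta>\<close>.\<close>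
  define \<beta> where "\<beta> = \<alpha> * g ^ ?N"
  have \<beta>: "0 < \<beta>" using g \<alpha> by (simp add: \<beta>_def)
  obtain c where c: "0 < c" "c *\<^sub>R P \<preceq> (ric \<beta> ^^ ?N) 0"
    using pos_def_ge_pos_def[OF pos_def_ric_iterate_0[OF obs \<beta>] P] by blast
  have "(c * trace Y) *\<^sub>R P \<preceq> (step \<alpha> ^^ ?N) Y" if Y: "psd Y" for Y
  proof (cases "Y = 0")
    case True
    then show ?thesis
      using psd_step_iterate[OF \<alpha> Y, of ?N] by (simp add: trace_def psd_iff_loewner)
  next
    case False
    define t where "t = trace Y"
    have t: "0 < t" using trace_pos[OF Y False] by (simp add: t_def)
    have tr: "g ^ j * t \<le> trace ((step \<alpha> ^^ j) Y)" for j
    proof (induction j)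
      case (Suc j)
      let ?X = "(step \<alpha> ^^ j) Y"
      have "psd ?X" using psd_step_iterate[OF \<alpha> Y] .
      then have "\<alpha> * trace ?X * trace (transpose C ** C) \<le> trace (step \<alpha> ?X)"
        using trace_mono[OF gram_le_ric[OF admissible_trace[OF _ \<alpha>]]]
        by (simp add: riccati_step_eq trace_scaleR)
      moreover have "g * trace ?X \<le> \<alpha> * trace (transpose C ** C) * trace ?X"
        using trace_nonneg[OF \<open>psd ?X\<close>] by (intro mult_right_mono) (auto simp: g_def)
      moreover have "g * (g ^ j * t) \<le> g * trace ?X"
        using Suc g by (intro mult_left_mono) auto
      ultimately show ?case by (simp add: mult_ac)
    qed (simp add: t_def)
    \<comment> \<open>The iteration therefore dominates the one with constant weight
      \<open>t * \<beta>\<close> started at 0. Homogeneity then extracts \<open>t\<close>, which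
      makes \<open>c\<close> independent of \<open>Y\<close>.\<close>
    have "(ric (t * \<beta>) ^^ j) 0 \<preceq> (step \<alpha> ^^ j) Y" if "j \<le> ?N" for j
      using that
    proof (induction j)
      case (Suc j)
      let ?X = "(step \<alpha> ^^ j) Y"
      have "g ^ ?N * t \<le> g ^ j * t"
        using g t Suc.prems by (intro mult_right_mono power_decreasing) auto
      then have "\<alpha> * (g ^ ?N * t) \<le> \<alpha> * trace ?X"
        using tr[of j] \<alpha> by (intro mult_left_mono) auto
      then have "t * \<beta> \<le> \<alpha> * trace ?X"
        by (simp add: \<beta>_def mult_ac)
      moreover have "admissible (\<alpha> * trace ?X) ?X"
        by (intro admissible_trace psd_step_iterate \<alpha> Y)
      moreover have "admissible (t * \<beta>) ((ric (t * \<beta>) ^^ j) 0)"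
        using t \<beta> by (intro admissibleI psd_ric_iterate) auto
      moreover have "(ric (t * \<beta>) ^^ j) 0 \<preceq> ?X"
        using Suc by simp
      ultimately have "ric (t * \<beta>) ((ric (t * \<beta>) ^^ j) 0) \<preceq> step \<alpha> ?X"
        unfolding riccati_step_eq[of \<alpha> ?X] by (intro ric_mono)
      then show ?case by simp
    qed (use Y in \<open>simp add: psd_iff_loewner\<close>)
    from this[of ?N] have "t *\<^sub>R (ric \<beta> ^^ ?N) 0 \<preceq> (step \<alpha> ^^ ?N) Y"
      using ric_iterate_scaleR[OF \<beta> t psd_0, of ?N] by simp
    moreover have "(c * t) *\<^sub>R P \<preceq> t *\<^sub>R (ric \<beta> ^^ ?N) 0"
      using loewner_le_scaleR[OF c(2), of t] t by (simp add: mult.commute)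
    ultimately have "(c * t) *\<^sub>R P \<preceq> (step \<alpha> ^^ ?N) Y"
      by (rule loewner_le_trans[rotated])
    then show ?thesis
      by (simp only: t_def)
  qed
  with c(1) show ?thesis using that by blast
qed

lemma step_iterate_hilbert_dist:
  assumes obs: "observable A C" and P: "pos_def P" "ric 1 P = P" and \<alpha>: "0 < \<alpha>" "\<alpha> * trace P = 1"
    and X: "psd X" "X \<noteq> 0"
  shows "(\<lambda>k. hilbert_dist ((step \<alpha> ^^ k) X) P) \<longlonglongrightarrow> 0"
proof -
  let ?N = "CARD('n)"
  have psdP: "psd P" using P by (simp add: pos_def_imp_psd)
  note fixed = step_iterate_fixed[OF psdP P(2) \<alpha>(2)]
  obtain c where c: "0 < c" "\<And>Y. psd Y \<Longrightarrow> (c * trace Y) *\<^sub>R P \<preceq> (step \<alpha> ^^ ?N) Y"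
    using step_iterate_lower_bound[OF obs P(1) \<alpha>(1)] by blast
  obtain D where D: "0 < D" "\<And>Y. psd Y \<Longrightarrow> Y \<preceq> (D * trace Y) *\<^sub>R P"
    using psd_le_pos_def_trace[OF P(1)] by blast
  \<comment> \<open>Sampling every \<open>n\<close> steps, because the uniform lower bound needs
    \<open>n\<close> of them.\<close>
  define y where "y k = (step \<alpha> ^^ (k * ?N)) X" for k
  have y_Suc: "y (Suc k) = (step \<alpha> ^^ ?N) (y k)" for k
    by (simp add: y_def funpow_add)
  \<comment> \<open>Each round adds to the lower factor what the bound \<open>c\<close> guarantees
    for the remainder \<open>y k - a k P\<close>, whose trace is \<open>t k\<close>.\<close>
  define a where "a = rec_nat 0 (\<lambda>k s. s + c * (trace (y k) - s * trace P))"
  define t where "t k = trace (y k) - a k * trace P" for k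
  have a_0: "a 0 = 0" and a_Suc: "a (Suc k) = a k + c * t k" for k
    by (simp_all add: a_def t_def)
  have inv: "0 \<le> a k \<and> a k *\<^sub>R P \<preceq> y k" for k
  proof (induction k)
    case (Suc k)
    define Y where "Y = y k - a k *\<^sub>R P"
    have Y: "psd Y" and tr: "trace Y = t k"
      using Suc by (auto simp: Y_def loewner_le_def t_def trace_sub trace_scaleR)
    have "a (Suc k) *\<^sub>R P = a k *\<^sub>R P + (c * trace Y) *\<^sub>R P"
      by (simp add: a_Suc tr scaleR_add_left)
    also have "\<dots> \<preceq> (step \<alpha> ^^ ?N) (a k *\<^sub>R P) + (step \<alpha> ^^ ?N) Y"
      using c(2)[OF Y] Suc by (intro loewner_le_add) (auto simp: fixed)
    also have "\<dots> \<preceq> (step \<alpha> ^^ ?N) (a k *\<^sub>R P + Y)"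
      using Suc psdP by (intro step_iterate_superadditive \<alpha> Y psd_scaleR) auto
    also have "\<dots> = y (Suc k)"
      by (simp add: Y_def y_Suc)
    finally show ?case
      using Suc c(1) trace_nonneg[OF Y] by (simp add: a_Suc tr)
  qed (use X in \<open>simp add: a_0 y_def psd_iff_loewner\<close>)
  have t_nonneg: "0 \<le> t k" for k
    using trace_mono[of "a k *\<^sub>R P" "y k"] inv by (simp add: t_def trace_scaleR)
  have "incseq a"
    using t_nonneg c(1) by (intro incseq_SucI) (simp add: a_Suc)
  \<comment> \<open>Multiples of \<open>P\<close> are fixed, so the initial upper bound on
    \<open>X\<close> persists and caps the lower factors.\<close>
  moreover have "a k \<le> D * trace X" for k
  proof (rule pos_def_scaleR_le[OF P(1)])
    have "y k \<preceq> (step \<alpha> ^^ (k * ?N)) ((D * trace X) *\<^sub>R P)"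
      unfolding y_def by (rule step_iterate_mono[OF \<alpha>(1) X(1) D(2)[OF X(1)]])
    then have "y k \<preceq> (D * trace X) *\<^sub>R P"
      using fixed[of "D * trace X"] D(1) trace_nonneg[OF X(1)] by simp
    then show "a k *\<^sub>R P \<preceq> (D * trace X) *\<^sub>R P"
      using inv loewner_le_trans by blast
  qed
  ultimately obtain L where L: "a \<longlonglongrightarrow> L"
    using incseq_convergent by blast
  \<comment> \<open>The increments of the convergent sequence \<open>a\<close> are
    \<open>c * t k\<close>.\<close>
  have "(\<lambda>k. (a (Suc k) - a k) / c) \<longlonglongrightarrow> (L - L) / c"
    using c(1) by (intro tendsto_intros LIMSEQ_Suc L) auto
  then have t: "t \<longlonglongrightarrow> 0"
    using c(1) by (simp add: a_Suc)
  \<comment> \<open>\<open>a 0\<close> is 0, so ratios make sense only from the first sample on;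
    \<open>a 1\<close> then serves as a uniform denominator.\<close>
  have "0 < a 1"
    using a_Suc[of 0] c(1) trace_pos[OF X] by (simp add: a_0 t_def y_def)
  define e where "e k = ln (1 + D * t k / a 1)" for k
  have "e \<longlonglongrightarrow> ln (1 + D * 0 / a 1)"
    unfolding e_def by (intro tendsto_intros t) (use \<open>0 < a 1\<close> in auto)
  then have e: "e \<longlonglongrightarrow> 0" by simp
  \<comment> \<open>Both bounds at sample \<open>k\<close> are fixed multiples of \<open>P\<close>,
    so by monotonicity they hold at every later step \<open>j\<close>, not only at samples.\<close>
  have dist: "0 \<le> hilbert_dist ((step \<alpha> ^^ j) X) P \<and> hilbert_dist ((step \<alpha> ^^ j) X) P \<le> ereal (e k)"
    if "1 \<le> k" "k * ?N \<le> j" for j k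
  proof -
    let ?x = "(step \<alpha> ^^ j) X"
    define i where "i = j - k * ?N"
    have x: "?x = (step \<alpha> ^^ i) (y k)"
      using that(2) by (simp add: y_def i_def flip: funpow_add[THEN fun_cong, unfolded o_apply])
    have ak: "a 1 \<le> a k"
      using \<open>incseq a\<close> that(1) by (simp add: incseq_def)
    have psd_y: "psd (y k)"
      using psd_step_iterate[OF \<alpha>(1) X(1)] by (simp add: y_def)
    have "(step \<alpha> ^^ i) (a k *\<^sub>R P) \<preceq> ?x"
      unfolding x using inv psdP by (intro step_iterate_mono \<alpha> psd_scaleR) auto
    then have lower: "a k *\<^sub>R P \<preceq> ?x"
      using inv fixed by simp
    have "y k - a k *\<^sub>R P \<preceq> (D * t k) *\<^sub>R P"
      using D(2)[of "y k - a k *\<^sub>R P"] inv[of k]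
      by (simp add: t_def trace_sub trace_scaleR loewner_le_def)
    then have "y k \<preceq> (a k + D * t k) *\<^sub>R P"
      by (simp add: loewner_le_def algebra_simps)
    then have "?x \<preceq> (step \<alpha> ^^ i) ((a k + D * t k) *\<^sub>R P)"
      unfolding x by (intro step_iterate_mono \<alpha> psd_y)
    then have upper: "?x \<preceq> (a k + D * t k) *\<^sub>R P"
      using fixed inv D(1) t_nonneg[of k] by simp
    have "0 < a k" using ak \<open>0 < a 1\<close> by simp
    have "(a k + D * t k) / a k = 1 + D * t k / a k"
      using \<open>0 < a k\<close> by (simp add: add_divide_distrib)
    also have "\<dots> \<le> 1 + D * t k / a 1"
      using ak \<open>0 < a 1\<close> D(1) t_nonneg[of k] by (intro add_left_mono divide_left_mono) auto
    finally have "ln ((a k + D * t k) / a k) \<le> e k"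
      unfolding e_def using \<open>0 < a k\<close> D(1) t_nonneg[of k]
      by (intro ln_mono) (auto intro!: divide_pos_pos add_pos_nonneg)
    then show ?thesis
      using hilbert_dist_bounds[OF P(1) lower upper \<open>0 < a k\<close>] by (metis ereal_less_eq(3) order_trans)
  qed
  \<comment> \<open>\<open>j div n\<close> is the latest sample not after \<open>j\<close>; it tends
    to infinity and is eventually at least 1.\<close>
  have large: "\<forall>\<^sub>F j in sequentially. 1 \<le> j div ?N"
    using filterlim_at_top_div_const_nat[of ?N] by (simp add: filterlim_at_top)
  have "(\<lambda>j. ereal (e (j div ?N))) \<longlonglongrightarrow> ereal 0"
    by (intro tendsto_intros filterlim_compose[OF e] filterlim_at_top_div_const_nat) simp
  then have lim: "(\<lambda>j. ereal (e (j div ?N))) \<longlonglongrightarrow> 0"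
    by (simp add: zero_ereal_def)
  have "\<forall>\<^sub>F j in sequentially. 0 \<le> hilbert_dist ((step \<alpha> ^^ j) X) P
      \<and> hilbert_dist ((step \<alpha> ^^ j) X) P \<le> ereal (e (j div ?N))"
    using large by eventually_elim (rule dist; simp)
  then have bounds: "\<forall>\<^sub>F j in sequentially. 0 \<le> hilbert_dist ((step \<alpha> ^^ j) X) P"
    "\<forall>\<^sub>F j in sequentially. hilbert_dist ((step \<alpha> ^^ j) X) P \<le> ereal (e (j div ?N))"
    unfolding eventually_conj_iff by blast+
  show ?thesis
    by (rule tendsto_sandwich[OF bounds tendsto_const lim])
qed

end

theorem mainTheorem7:
  fixes A :: "real ^ 'n ^ 'n" and B :: "real ^ 'p ^ 'n" and C :: "real ^ 'n ^ 'm"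
    and R :: "real ^ 'p ^ 'p"
  assumes "pos_def R"
    and "controllable A B"
    and "observable A C"
  shows "(\<exists>!P. pos_def P \<and> dare A B C R P) \<and>
    (\<forall>P. pos_def P \<and> dare A B C R P \<longrightarrow>
      (\<exists>\<alpha>>0. \<forall>X :: nat \<Rightarrow> real ^ 'n ^ 'n.
         psd (X 1) \<and> X 1 \<noteq> 0 \<and> (\<forall>k\<ge>1. X (k + 1) = riccati_step A B C R \<alpha> (X k)) \<longrightarrow>
         (\<lambda>k. hilbert_dist (X k) P) \<longlonglongrightarrow> 0))"
proof (intro conjI allI impI)
  interpret riccati A B C R
    by unfold_locales (rule assms(1))
  show "\<exists>!P. pos_def P \<and> dare A B C R P"
    unfolding dare_iff using ex_ric_fixed[OF assms(2,3)] ric_fixed_le[OF assms(3)]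
    by (metis loewner_le_antisym)
  fix P assume "pos_def P \<and> dare A B C R P"
  then have P: "pos_def P" "ric 1 P = P"
    by (auto simp: dare_iff)
  \<comment> \<open>With this choice the weight at \<open>P\<close> is 1, so the iteration fixes the
    ray of \<open>P\<close>.\<close>
  define \<alpha> where "\<alpha> = 1 / trace P"
  have "0 < trace P"
    using pos_def_trace_pos[OF P(1)] .
  then have \<alpha>: "0 < \<alpha>" "\<alpha> * trace P = 1"
    by (auto simp: \<alpha>_def)
  have "(\<lambda>k. hilbert_dist (X k) P) \<longlonglongrightarrow> 0"
    if X: "psd (X 1)" "X 1 \<noteq> 0" "\<forall>k\<ge>1. X (k + 1) = riccati_step A B C R \<alpha> (X k)" for X
  \<comment> \<open>The recursion starts at index 1 and leaves \<open>X 0\<close> arbitrary, so the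
    limit is taken along the shifted sequence.\<close>
  proof (rule LIMSEQ_imp_Suc)
    have eq: "X (Suc k) = (step \<alpha> ^^ k) (X 1)" for k
    proof (induction k)
      case (Suc k)
      have "X (Suc (Suc k)) = step \<alpha> (X (Suc k))"
        using X(3)[rule_format, of "Suc k"] by simp
      then show ?case
        by (simp only: Suc funpow.simps o_apply)
    qed simp
    show "(\<lambda>k. hilbert_dist (X (Suc k)) P) \<longlonglongrightarrow> 0"
      unfolding eq by (rule step_iterate_hilbert_dist[OF assms(3) P \<alpha> X(1,2)])
  qed
  with \<alpha>(1) show "\<exists>\<alpha>>0. \<forall>X. psd (X 1) \<and> X 1 \<noteq> 0
      \<and> (\<forall>k\<ge>1. X (k + 1) = riccati_step A B C R \<alpha> (X k)) \<longrightarrow> (\<lambda>k. hilbert_dist (X k) P) \<longlonglongrightarrow> 0"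
    by blast
qed

end
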